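(* Let $(X,\rho)$ be a complete $b_v(s)$-metric space, where $v\in\mathbb{N}$ and $s\in[1,\infty)$. Let $T:X\to X$ be a mapping such that $$\rho(Tx,Ty)<\rho(x,y)$$ for all $x,y\in X$ with $x\neq y$. Furthermore, assume that for any $x\in X$ and any $\varepsilon>0$ there exist $\delta>0$ and $N\in\mathbb{N}$ such that for all $n,m\in\mathbb{N}$ with $n,m\ge N$, $$\rho(T^nx,T^mx)<s^2\varepsilon+\delta\ \Longrightarrow\ \rho(T^{n+1}x,T^{m+1}x)\le\varepsilon.$$ Then $T$ has a unique fixed point.
   Context: Let $X$ be a non-empty set, $v\in\mathbb{N}$ and $s\in[1,\infty)$. A function $\rho:X\times X\to\mathbb{R}$ is a $b_v(s)$-metric, and $(X,\rho)$ is a $b_v(s)$-metric space, if for all $x,y\in X$ and for all distinct points $u_1,\dots,u_v\in X$, each of them different from $x$ and $y$: (i) $\rho(x,y)\ge 0$, and $\rho(x,y)=0$ if and only if $x=y$; (ii) $\rho(x,y)=\rho(y,x)$; (iii) $\rho(x,y)\le s\left[\rho(x,u_1)+\rho(u_1,u_2)+\cdots+\rho(u_v,y)\right]$. A sequence $\{x_n\}$ in $X$ converges to $x\in X$ if $\rho(x_n,x)\to 0$ as $n\to\infty$; it is Cauchy if $\rho(x_n,x_m)\to 0$ as $n,m\to\infty$. The space $(X,\rho)$ is complete if every Cauchy sequence in $X$ converges to some point of $X$. *)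

theory Defs
  imports Complex_Main "HOL-Library.FuncSet"
begin

(* The intermediate points u_1, ..., u_v are u 1, ..., u v; values of u outside {1..v}
   are irrelevant.  The points x and y may coincide. *)
locale bv_metric_space =
  fixes X :: "'a set" and \<rho> :: "'a \<Rightarrow> 'a \<Rightarrow> real" and v :: nat and s :: real
  assumes nonempty: "X \<noteq> {}"
    and v_pos: "1 \<le> v"
    and s_ge_1: "1 \<le> s"
    and nonneg: "\<lbrakk>x \<in> X; y \<in> X\<rbrakk> \<Longrightarrow> 0 \<le> \<rho> x y"
    and zero_iff: "\<lbrakk>x \<in> X; y \<in> X\<rbrakk> \<Longrightarrow> \<rho> x y = 0 \<longleftrightarrow> x = y"
    and commute: "\<lbrakk>x \<in> X; y \<in> X\<rbrakk> \<Longrightarrow> \<rho> x y = \<rho> y x"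
    and polygon: "\<lbrakk>x \<in> X; y \<in> X; u \<in> {1..v} \<rightarrow> X - {x, y}; inj_on u {1..v}\<rbrakk> \<Longrightarrow>
      \<rho> x y \<le> s * (\<rho> x (u 1) + (\<Sum>i = 1..<v. \<rho> (u i) (u (i + 1))) + \<rho> (u v) y)"

definition bv_converges :: "('a \<Rightarrow> 'a \<Rightarrow> real) \<Rightarrow> (nat \<Rightarrow> 'a) \<Rightarrow> 'a \<Rightarrow> bool" where
  "bv_converges \<rho> \<sigma> x \<longleftrightarrow> (\<lambda>n. \<rho> (\<sigma> n) x) \<longlonglongrightarrow> 0"

definition bv_Cauchy :: "('a \<Rightarrow> 'a \<Rightarrow> real) \<Rightarrow> (nat \<Rightarrow> 'a) \<Rightarrow> bool" where
  "bv_Cauchy \<rho> \<sigma> \<longleftrightarrow>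
     ((\<lambda>(n, m). \<rho> (\<sigma> n) (\<sigma> m)) \<longlongrightarrow> 0) (sequentially \<times>\<^sub>F sequentially)"

definition bv_complete :: "'a set \<Rightarrow> ('a \<Rightarrow> 'a \<Rightarrow> real) \<Rightarrow> bool" where
  "bv_complete X \<rho> \<longleftrightarrow>
     (\<forall>\<sigma>. range \<sigma> \<subseteq> X \<and> bv_Cauchy \<rho> \<sigma> \<longrightarrow> (\<exists>x\<in>X. bv_converges \<rho> \<sigma> x))"

end

theory Submission
  imports Defs
begin

text \<open>
  Fix a starting point and write \<open>x\<^sub>n\<close> for its \<open>n\<close>-th iterate under \<open>T\<close>. If two consecutive
  iterates coincide, they are a fixed point. Otherwise all iterates are distinct (a repetition would
  make the orbit periodic, whereas the distances \<open>\<rho> x\<^sub>n x\<^sub>n\<^sub>+\<^sub>1\<close> strictly decrease), so that any \<open>v\<close> of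
  them may serve as intermediate points in the polygon inequality.

  For each fixed \<open>k\<close> the distances \<open>\<rho> x\<^sub>n x\<^sub>n\<^sub>+\<^sub>k\<close> decrease, and the Meir--Keeler type hypothesis forces
  their limit to be \<open>0\<close>. Distances over unbounded gaps are then controlled by induction on the gap:
  the path \<open>x\<^sub>n, x\<^sub>n\<^sub>+\<^sub>v, x\<^sub>n\<^sub>+\<^sub>v\<^sub>-\<^sub>1, \<dots>, x\<^sub>n\<^sub>+\<^sub>1, x\<^sub>m\<close> has exactly \<open>v\<close> intermediate points, and all its edges
  except the last are short; so \<open>\<rho> x\<^sub>n\<^sub>+\<^sub>1 x\<^sub>m \<le> \<epsilon>\<close> gives \<open>\<rho> x\<^sub>n x\<^sub>m < s \<epsilon> + \<delta> \<le> s\<^sup>2 \<epsilon> + \<delta>\<close>, and the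
  hypothesis returns \<open>\<rho> x\<^sub>n\<^sub>+\<^sub>1 x\<^sub>m\<^sub>+\<^sub>1 \<le> \<epsilon>\<close>. Hence the orbit is Cauchy. The metric need not be
  continuous, but the path \<open>p, x\<^sub>n\<^sub>+\<^sub>v, \<dots>, x\<^sub>n\<^sub>+\<^sub>1, T p\<close> with short edges shows that the limit \<open>p\<close> is a
  fixed point. The lemmas \<open>gap_tendsto_0\<close>, \<open>orbit_Cauchy\<close> and \<open>orbit_limit_fixed\<close> carry these steps.
\<close>

section \<open>Polygons along a sequence\<close>

text \<open>
  The points are traversed in decreasing index order, so that the path leaves \<open>p\<close> towards
  \<open>g (n + v)\<close> and reaches \<open>q\<close> from \<open>g (n + 1)\<close>. This is what allows \<open>p = g n\<close> with only a bounded
  gap on the first edge, while the last edge starts from the successor of \<open>g n\<close>.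
\<close>
lemma (in bv_metric_space) polygon_along_sequence:
  fixes g :: "nat \<Rightarrow> 'a"
  assumes g: "range g \<subseteq> X" "inj g"
    and p: "p \<in> X" "\<And>i. n < i \<Longrightarrow> i \<le> n + v \<Longrightarrow> g i \<noteq> p"
    and q: "q \<in> X" "\<And>i. n < i \<Longrightarrow> i \<le> n + v \<Longrightarrow> g i \<noteq> q"
    and step: "\<And>i. n < i \<Longrightarrow> \<rho> (g i) (g (Suc i)) \<le> \<eta>"
  shows "\<rho> p q \<le> s * (\<rho> p (g (n + v)) + real (v - 1) * \<eta> + \<rho> (g (Suc n)) q)"
proof -
  define u where "u = (\<lambda>i. g (n + v + 1 - i))"
  have gX: "g i \<in> X" for i using g(1) by auto
  have u_mem: "u \<in> {1..v} \<rightarrow> X - {p, q}"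
  proof
    fix i assume "i \<in> {1..v}"
    then have "n < n + v + 1 - i" "n + v + 1 - i \<le> n + v" by auto
    then show "u i \<in> X - {p, q}" using p(2) q(2) gX by (auto simp: u_def)
  qed
  have "inj_on u {1..v}"
    unfolding u_def by (rule inj_onI) (use injD[OF g(2)] in fastforce)
  with u_mem have "\<rho> p q \<le> s * (\<rho> p (u 1) + (\<Sum>i = 1..<v. \<rho> (u i) (u (i + 1))) + \<rho> (u v) q)"
    using polygon p(1) q(1) by blast
  moreover have "(\<Sum>i = 1..<v. \<rho> (u i) (u (i + 1))) \<le> real (v - 1) * \<eta>"
  proof -
    have "\<rho> (u i) (u (i + 1)) \<le> \<eta>" if "i \<in> {1..<v}" for i
    proof -
      define j where "j = n + v - i"
      have "u i = g (Suc j)" "u (i + 1) = g j" using that by (auto simp: u_def j_def Suc_diff_le)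
      moreover have "n < j" using that by (auto simp: j_def)
      ultimately show ?thesis using step[of j] commute[OF gX gX, of j "Suc j"] by simp
    qed
    then show ?thesis using sum_bounded_above[of "{1..<v}" "\<lambda>i. \<rho> (u i) (u (i + 1))" \<eta>] by simp
  qed
  moreover have "u 1 = g (n + v)" "u v = g (Suc n)" by (auto simp: u_def)
  ultimately show ?thesis
    using s_ge_1 by (smt (verit) mult_left_mono)
qed

section \<open>Orbits of a contractive map\<close>

locale contractive_self_map = bv_metric_space X \<rho> v s
  for X :: "'a set" and \<rho> v s +
  fixes T :: "'a \<Rightarrow> 'a"
  assumes maps: "T \<in> X \<rightarrow> X"
    and contractive: "\<lbrakk>x \<in> X; y \<in> X; x \<noteq> y\<rbrakk> \<Longrightarrow> \<rho> (T x) (T y) < \<rho> x y"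
begin

definition meir_keeler_orbit :: "'a \<Rightarrow> bool" where
  "meir_keeler_orbit x \<longleftrightarrow> (\<forall>\<epsilon>>0. \<exists>\<delta>>0. \<exists>N. \<forall>n\<ge>N. \<forall>m\<ge>N.
      \<rho> ((T ^^ n) x) ((T ^^ m) x) < s\<^sup>2 * \<epsilon> + \<delta> \<longrightarrow>
      \<rho> ((T ^^ Suc n) x) ((T ^^ Suc m) x) \<le> \<epsilon>)"

lemma orbit_in: "x \<in> X \<Longrightarrow> (T ^^ n) x \<in> X"
  by (induction n) (use maps in auto)

lemma nonexpansive: "\<lbrakk>x \<in> X; y \<in> X\<rbrakk> \<Longrightarrow> \<rho> (T x) (T y) \<le> \<rho> x y"
  using contractive[of x y] maps zero_iff[of "T x" "T y"] zero_iff[of x y] by fastforce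

text \<open>
  A repetition \<open>x\<^sub>i = x\<^sub>j\<close> entails \<open>x\<^sub>i\<^sub>+\<^sub>1 = x\<^sub>j\<^sub>+\<^sub>1\<close>, so the strictly decreasing sequence of consecutive
  distances would take the same value at \<open>i\<close> and \<open>j\<close>.
\<close>
lemma orbit_inj:
  assumes x: "x \<in> X" and moving: "\<And>n. T ((T ^^ n) x) \<noteq> (T ^^ n) x"
  shows "inj (\<lambda>n. (T ^^ n) x)"
proof -
  define a where "a = (\<lambda>n. \<rho> ((T ^^ n) x) ((T ^^ Suc n) x))"
  have "a (Suc n) < a n" for n
    using contractive[OF orbit_in[OF x] orbit_in[OF x], of n "Suc n"] moving[of n]
    by (simp add: a_def)
  then have dec: "i < j \<Longrightarrow> a j < a i" for i j
    using lift_Suc_mono_less[of "\<lambda>n. - a n" i j] by auto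
  show ?thesis
  proof (rule linorder_injI)
    fix i j :: nat assume "i < j"
    then show "(T ^^ i) x \<noteq> (T ^^ j) x" using dec[of i j] by (auto simp: a_def)
  qed
qed

text \<open>
  With \<open>L\<close> the limit of the decreasing distances and \<open>L > 0\<close>, the Meir--Keeler condition for
  \<open>\<epsilon> = L / s\<^sup>2\<close> applies as soon as a distance is below \<open>L + \<delta>\<close>. It brings the next distance down to at
  most \<open>L / s\<^sup>2 \<le> L\<close>, and strict contraction brings the following one below \<open>L\<close>.
\<close>
lemma gap_tendsto_0:
  assumes x: "x \<in> X" and mk: "meir_keeler_orbit x"
  shows "(\<lambda>n. \<rho> ((T ^^ n) x) ((T ^^ (n + k)) x)) \<longlonglongrightarrow> 0"
proof -
  define a where "a = (\<lambda>n. \<rho> ((T ^^ n) x) ((T ^^ (n + k)) x))"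
  have a_nonneg: "0 \<le> a n" for n using nonneg orbit_in[OF x] by (simp add: a_def)
  have "decseq a"
    using nonexpansive[OF orbit_in[OF x] orbit_in[OF x]]
    by (intro decseq_SucI) (simp add: a_def)
  then obtain L where lim: "a \<longlonglongrightarrow> L" and lower: "\<And>n. L \<le> a n"
    using decseq_convergent[of a 0] a_nonneg by blast
  have "L \<ge> 0" using LIMSEQ_le_const[OF lim] a_nonneg by blast
  have "\<not> 0 < L"
  proof
    assume "0 < L"
    have s2: "1 \<le> s\<^sup>2" using s_ge_1 by simp
    define \<epsilon> where "\<epsilon> = L / s\<^sup>2"
    have eps: "0 < \<epsilon>" "s\<^sup>2 * \<epsilon> = L" "\<epsilon> \<le> L"
      using \<open>0 < L\<close> s2 s_ge_1 by (auto simp: \<epsilon>_def divide_le_eq)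
    obtain \<delta> N where "0 < \<delta>" and N: "\<And>n. n \<ge> N \<Longrightarrow> a n < L + \<delta> \<Longrightarrow> a (Suc n) \<le> \<epsilon>"
      using mk eps(1,2) unfolding meir_keeler_orbit_def a_def
      by (metis add_Suc trans_le_add1)
    have "\<forall>\<^sub>F n in sequentially. a n < L + \<delta>"
      using order_tendstoD(2)[OF lim] \<open>0 < \<delta>\<close> by simp
    then obtain M where "\<And>n. n \<ge> M \<Longrightarrow> a n < L + \<delta>"
      by (auto simp: eventually_sequentially)
    then have "a (max M N) < L + \<delta>" by simp
    from N[OF _ this] eps(3) have "a (Suc (max M N)) \<le> L" by simp
    then obtain n where "a (Suc n) \<le> L" by blast
    moreover have "a (Suc (Suc n)) < a (Suc n)"
    proof -
      have "(T ^^ Suc n) x \<noteq> (T ^^ (Suc n + k)) x"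
        using lower[of "Suc n"] \<open>0 < L\<close> zero_iff[OF orbit_in[OF x] orbit_in[OF x]]
        by (simp only: a_def) (metis less_irrefl order_less_le_trans)
      from contractive[OF orbit_in[OF x] orbit_in[OF x] this] show ?thesis
        by (simp add: a_def)
    qed
    ultimately show False using lower[of "Suc (Suc n)"] by simp
  qed
  with \<open>L \<ge> 0\<close> lim show ?thesis by (simp add: a_def)
qed

section \<open>Convergence of the orbit to a fixed point\<close>

text \<open>
  The induction over \<open>m\<close> bounds \<open>\<rho> x\<^sub>n\<^sub>+\<^sub>1 x\<^sub>m\<close> by \<open>\<epsilon>\<close> itself, with no loss from step to step: the polygon
  inequality multiplies the bound by \<open>s\<close> and adds less than \<open>\<delta>\<close>, and the Meir--Keeler condition undoes
  both. The path is admissible only for \<open>m > n + v\<close>; smaller gaps are covered by \<open>gap_tendsto_0\<close>,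
  uniformly because there are finitely many of them.
\<close>
lemma orbit_Cauchy:
  assumes x: "x \<in> X" and inj: "inj (\<lambda>n. (T ^^ n) x)" and mk: "meir_keeler_orbit x"
  shows "bv_Cauchy \<rho> (\<lambda>n. (T ^^ n) x)"
proof -
  define g where "g = (\<lambda>n. (T ^^ n) x)"
  have gX: "g n \<in> X" for n using orbit_in[OF x] by (simp add: g_def)
  have tail: "\<exists>M. \<forall>n\<ge>M. \<forall>m\<ge>n. \<rho> (g n) (g m) \<le> \<epsilon>" if "0 < \<epsilon>" for \<epsilon> :: real
  proof -
    obtain \<delta> N where "0 < \<delta>" and N: "\<And>n m. \<lbrakk>n \<ge> N; m \<ge> N; \<rho> (g n) (g m) < s\<^sup>2 * \<epsilon> + \<delta>\<rbrakk>
        \<Longrightarrow> \<rho> (g (Suc n)) (g (Suc m)) \<le> \<epsilon>"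
      using mk \<open>0 < \<epsilon>\<close> unfolding meir_keeler_orbit_def g_def by meson
    \<comment> \<open>The \<open>v\<close> short edges of the path, scaled by \<open>s\<close>, must together stay below \<open>\<delta>\<close>; short gaps must
      also stay below \<open>\<epsilon>\<close> to start the induction.\<close>
    define \<eta> where "\<eta> = min \<epsilon> (\<delta> / (2 * s * real v))"
    have sv: "0 < s * real v" using s_ge_1 v_pos by simp
    then have "0 < \<eta>" using \<open>0 < \<epsilon>\<close> \<open>0 < \<delta>\<close> by (simp add: \<eta>_def)
    have "s * real v * \<eta> \<le> s * real v * (\<delta> / (2 * s * real v))"
      using sv by (intro mult_left_mono) (auto simp: \<eta>_def)
    also have "\<dots> = \<delta> / 2" using sv by (auto simp: field_simps)
    finally have small: "s * real v * \<eta> < \<delta>" using \<open>0 < \<delta>\<close> by simp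
    have "\<forall>\<^sub>F n in sequentially. \<forall>k\<in>{..v}. \<rho> (g n) (g (n + k)) < \<eta>"
      using order_tendstoD(2)[OF gap_tendsto_0[OF x mk] \<open>0 < \<eta>\<close>]
      by (intro eventually_ball_finite) (auto simp: g_def)
    then obtain M where M: "\<And>n k. \<lbrakk>n \<ge> M; k \<le> v\<rbrakk> \<Longrightarrow> \<rho> (g n) (g (n + k)) < \<eta>"
      by (auto simp: eventually_sequentially)
    have bound: "\<rho> (g (Suc n)) (g m) \<le> \<epsilon>" if n: "n \<ge> max M N" and "m \<ge> Suc n" for n m
      using that(2)
    proof (induction m rule: dec_induct)
      case base
      then show ?case using zero_iff[OF gX gX] \<open>0 < \<epsilon>\<close> by (metis less_imp_le)
    next
      case (step m)
      show ?case
      proof (cases "m \<le> n + v")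
        case True
        then have "\<rho> (g (Suc n)) (g (Suc n + (m - n))) < \<eta>" using n by (intro M) auto
        moreover have "Suc n + (m - n) = Suc m" using step.hyps by simp
        ultimately show ?thesis by (simp only: \<eta>_def)
      next
        case False
        have short: "\<rho> (g i) (g (Suc i)) \<le> \<eta>" if "n < i" for i
          using M[of i 1] that n v_pos by (simp add: less_imp_le)
        have "range g \<subseteq> X" "inj g" using gX inj by (auto simp: g_def)
        then have "\<rho> (g n) (g m)
            \<le> s * (\<rho> (g n) (g (n + v)) + real (v - 1) * \<eta> + \<rho> (g (Suc n)) (g m))"
          by (rule polygon_along_sequence) (use gX False short in \<open>auto simp: inj_eq[OF \<open>inj g\<close>]\<close>)
        also have "\<dots> \<le> s * (\<eta> + real (v - 1) * \<eta> + \<epsilon>)"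
          using M[of n v] n step.IH s_ge_1 by (intro mult_left_mono) auto
        also have "\<dots> = s * real v * \<eta> + s * \<epsilon>"
          using v_pos by (simp add: algebra_simps)
        also have "\<dots> < s\<^sup>2 * \<epsilon> + \<delta>"
        proof -
          have "s * \<epsilon> \<le> s\<^sup>2 * \<epsilon>"
            using s_ge_1 \<open>0 < \<epsilon>\<close> by (intro mult_right_mono) (auto simp: power2_eq_square)
          then show ?thesis using small by simp
        qed
        finally show ?thesis using n step.hyps by (intro N) auto
      qed
    qed
    have "\<rho> (g n) (g m) \<le> \<epsilon>" if "n \<ge> Suc (max M N)" "m \<ge> n" for n m
      using bound[of "n - 1" m] that by (cases n) auto
    then show ?thesis by blast
  qed
  show ?thesis
    unfolding bv_Cauchy_def g_def[symmetric]
  proof (rule tendstoI)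
    fix e :: real assume "0 < e"
    then obtain M where M: "\<forall>n\<ge>M. \<forall>m\<ge>n. \<rho> (g n) (g m) \<le> e / 2" using tail[of "e / 2"] by auto
    have "\<rho> (g n) (g m) < e" if "n \<ge> M" "m \<ge> M" for n m
    proof -
      have "\<rho> (g n) (g m) \<le> e / 2"
        using M that commute[OF gX gX, of n m] by (metis nat_le_linear)
      then show ?thesis using \<open>0 < e\<close> by simp
    qed
    then have "\<forall>n\<ge>M. \<forall>m\<ge>M. dist (\<rho> (g n) (g m)) 0 < e"
      using nonneg[OF gX gX] by simp
    then show "\<forall>\<^sub>F p in sequentially \<times>\<^sub>F sequentially.
        dist (case p of (n, m) \<Rightarrow> \<rho> (g n) (g m)) 0 < e"
      unfolding eventually_prod_sequentially by auto
  qed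
qed

text \<open>
  Nonexpansiveness gives \<open>\<rho> x\<^sub>n\<^sub>+\<^sub>1 (T p) \<le> \<rho> x\<^sub>n p\<close>, so every edge of the path from \<open>p\<close> to \<open>T p\<close> along the
  orbit tends to \<open>0\<close>. Injectivity keeps the orbit away from \<open>p\<close> and \<open>T p\<close> from some index on, which
  makes the path admissible.
\<close>
lemma orbit_limit_fixed:
  assumes x: "x \<in> X" and inj: "inj (\<lambda>n. (T ^^ n) x)" and mk: "meir_keeler_orbit x"
    and p: "p \<in> X" and conv: "bv_converges \<rho> (\<lambda>n. (T ^^ n) x) p"
  shows "T p = p"
proof -
  define g where "g = (\<lambda>n. (T ^^ n) x)"
  have gX: "g n \<in> X" for n using orbit_in[OF x] by (simp add: g_def)
  have Tp: "T p \<in> X" using p maps by auto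
  have g: "range g \<subseteq> X" "inj g" using gX inj by (auto simp: g_def)
  have lim: "(\<lambda>n. \<rho> (g n) p) \<longlonglongrightarrow> 0" using conv by (simp add: bv_converges_def g_def)
  have gap: "(\<lambda>n. \<rho> (g n) (g (Suc n))) \<longlonglongrightarrow> 0"
    using gap_tendsto_0[OF x mk, of 1] by (simp add: g_def)
  have avoid: "\<forall>\<^sub>F n in sequentially. g n \<noteq> c" for c
  proof -
    have "finite {n. g n = c}"
      using finite_vimageI[OF _ g(2), of "{c}"] by (simp add: vimage_def)
    then show ?thesis by (simp add: cofinite_eq_sequentially[symmetric] eventually_cofinite)
  qed
  have "\<rho> p (T p) \<le> e" if "0 < e" for e :: real
  proof -
    define \<eta> where "\<eta> = e / (s * real (v + 1))"
    have sv: "0 < s * real (v + 1)" using s_ge_1 by simp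
    then have "0 < \<eta>" using \<open>0 < e\<close> by (simp add: \<eta>_def)
    have "\<forall>\<^sub>F n in sequentially. g n \<noteq> p \<and> g n \<noteq> T p \<and> \<rho> (g n) p < \<eta> \<and> \<rho> (g n) (g (Suc n)) < \<eta>"
      using order_tendstoD(2)[OF lim \<open>0 < \<eta>\<close>] order_tendstoD(2)[OF gap \<open>0 < \<eta>\<close>]
        avoid[of p] avoid[of "T p"]
      by eventually_elim simp
    then obtain M where M: "\<And>n. n \<ge> M \<Longrightarrow>
        g n \<noteq> p \<and> g n \<noteq> T p \<and> \<rho> (g n) p < \<eta> \<and> \<rho> (g n) (g (Suc n)) < \<eta>"
      by (auto simp: eventually_sequentially)
    have "\<rho> p (T p) \<le> s * (\<rho> p (g (M + v)) + real (v - 1) * \<eta> + \<rho> (g (Suc M)) (T p))"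
      using M by (intro polygon_along_sequence g p Tp) (auto simp: less_imp_le)
    also have "\<dots> \<le> s * (\<eta> + real (v - 1) * \<eta> + \<eta>)"
    proof (intro mult_left_mono add_mono order_refl)
      show "\<rho> p (g (M + v)) \<le> \<eta>" using M[of "M + v"] commute[OF p gX, of "M + v"] by simp
      have "\<rho> (g (Suc M)) (T p) \<le> \<rho> (g M) p" using nonexpansive[OF gX p] by (simp add: g_def)
      then show "\<rho> (g (Suc M)) (T p) \<le> \<eta>" using M[of M] by simp
    qed (use s_ge_1 in auto)
    also have "\<dots> = s * real (v + 1) * \<eta>" using v_pos by (simp add: algebra_simps)
    also have "\<dots> = e" using s_ge_1 by (simp add: \<eta>_def)
    finally show ?thesis .
  qed
  then have "\<rho> p (T p) \<le> 0" by (rule field_le_epsilon) simp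
  then have "\<rho> p (T p) = 0" using nonneg[OF p Tp] by simp
  then show ?thesis using zero_iff[OF p Tp] by simp
qed

end

theorem corollary2p14:
  fixes X :: "'a set" and \<rho> :: "'a \<Rightarrow> 'a \<Rightarrow> real" and v :: nat and s :: real
    and T :: "'a \<Rightarrow> 'a"
  assumes "bv_metric_space X \<rho> v s"
    and "bv_complete X \<rho>"
    and "T \<in> X \<rightarrow> X"
    and "\<And>x y. \<lbrakk>x \<in> X; y \<in> X; x \<noteq> y\<rbrakk> \<Longrightarrow> \<rho> (T x) (T y) < \<rho> x y"
    and "\<And>x \<epsilon>. \<lbrakk>x \<in> X; \<epsilon> > 0\<rbrakk> \<Longrightarrow>
      \<exists>\<delta>>0. \<exists>N. \<forall>n\<ge>N. \<forall>m\<ge>N.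
        \<rho> ((T ^^ n) x) ((T ^^ m) x) < s\<^sup>2 * \<epsilon> + \<delta> \<longrightarrow>
        \<rho> ((T ^^ (n + 1)) x) ((T ^^ (m + 1)) x) \<le> \<epsilon>"
  shows "\<exists>!x. x \<in> X \<and> T x = x"
proof -
  interpret bv_metric_space X \<rho> v s by fact
  interpret contractive_self_map X \<rho> v s T
    by unfold_locales (use assms(3,4) in auto)
  obtain x where x: "x \<in> X" using nonempty by blast
  have mk: "meir_keeler_orbit x"
    using assms(5)[OF x] by (simp add: meir_keeler_orbit_def)
  have "\<exists>p\<in>X. T p = p"
  proof (cases "\<exists>n. T ((T ^^ n) x) = (T ^^ n) x")
    case True
    then show ?thesis using orbit_in[OF x] by blast
  next
    case False
    then have inj: "inj (\<lambda>n. (T ^^ n) x)" using orbit_inj[OF x] by blast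
    have "range (\<lambda>n. (T ^^ n) x) \<subseteq> X" using orbit_in[OF x] by auto
    with orbit_Cauchy[OF x inj mk] have "\<exists>p\<in>X. bv_converges \<rho> (\<lambda>n. (T ^^ n) x) p"
      using assms(2) by (simp add: bv_complete_def)
    then obtain p where p: "p \<in> X" "bv_converges \<rho> (\<lambda>n. (T ^^ n) x) p" by auto
    have "T p = p" by (rule orbit_limit_fixed[OF x inj mk p])
    with p(1) show ?thesis by (rule bexI[rotated])
  qed
  moreover have "p = q" if "p \<in> X" "q \<in> X" "T p = p" "T q = q" for p q
    using contractive[of p q] that by auto
  ultimately show ?thesis by blast
qed

end
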